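(* Let $\mathscr{C}$ and $\mathscr{D}$ be monoidal categories with LR units $(I,\lambda^I,\rho^I)$ and $(J,\lambda^J,\rho^J)$ respectively, let $(F,\phi_2):\mathscr{C}\to\mathscr{D}$ be a strong multiplicative functor, and let $\phi_0:J\to F(I)$ be an isomorphism. For an object $X$ of $\mathscr{C}$ consider the conditions $$(L_X)\quad \lambda^J_{F(X)}=F(\lambda^I_X)\circ\phi_{I,X}\circ(\phi_0F(X)),\qquad (R_X)\quad \rho^J_{F(X)}=F(\rho^I_X)\circ\phi_{X,I}\circ(F(X)\phi_0).$$ Then $(L_X)$ holds for all $X$ if and only if $(R_X)$ holds for all $X$, and this can be measured on $I$ alone: each of these is equivalent to $(L_I)$, and to $(R_I)$.
   Context: A semi-monoidal category is a category with a strictly associative functor $\mathscr{C}\times\mathscr{C}\to\mathscr{C}$, written as juxtaposition. The identity arrow of an object $X$ is also written $X$. An LR unit is a triple $(I,\lambda,\rho)$ with $\lambda_X: IX\to X$, $\rho_X: XI\to X$ natural isomorphisms satisfying, for all $X,Y$: $\lambda_I=\rho_I$; $\lambda_{XY}=\lambda_X Y$; $\rho_{XY}=X\rho_Y$; $X\lambda_Y=\rho_X Y$. A monoidal category is here a semi-monoidal category with a chosen LR unit. A strong multiplicative functor $(F,\phi_2)$ is a functor $F$ with natural isomorphisms $\phi_{X,Y}:F(X)F(Y)\to F(XY)$ such that $\phi_{XY,Z}\circ(\phi_{X,Y}F(Z))=\phi_{X,YZ}\circ(F(X)\phi_{Y,Z})$. *)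

theory Defs
  imports Main
begin

section \<open>Categories, functors, natural isomorphisms\<close>

record ('o, 'a) category =
  Obj :: "'o set"
  Arr :: "'a set"
  Dom :: "'a \<Rightarrow> 'o"
  Cod :: "'a \<Rightarrow> 'o"
  Id :: "'o \<Rightarrow> 'a"
  Comp :: "'a \<Rightarrow> 'a \<Rightarrow> 'a"  (infixr "\<cdot>\<index>" 70)

definition hom :: "('o, 'a, 'm) category_scheme \<Rightarrow> 'o \<Rightarrow> 'o \<Rightarrow> 'a set" where
  "hom C X Y = {f \<in> Arr C. Dom C f = X \<and> Cod C f = Y}"

text \<open>\<open>g \<cdot> f\<close> is \<open>g\<close> after \<open>f\<close>; it is unconstrained when \<open>Cod f \<noteq> Dom g\<close>.\<close>

locale category =
  fixes C :: "('o, 'a, 'm) category_scheme" (structure)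
  assumes Dom_closed: "f \<in> Arr C \<Longrightarrow> Dom C f \<in> Obj C"
    and Cod_closed: "f \<in> Arr C \<Longrightarrow> Cod C f \<in> Obj C"
    and Id_in_hom: "X \<in> Obj C \<Longrightarrow> Id C X \<in> hom C X X"
    and Comp_in_hom: "f \<in> hom C X Y \<Longrightarrow> g \<in> hom C Y Z \<Longrightarrow> g \<cdot> f \<in> hom C X Z"
    and Comp_Id: "f \<in> hom C X Y \<Longrightarrow> f \<cdot> Id C X = f"
    and Id_Comp: "f \<in> hom C X Y \<Longrightarrow> Id C Y \<cdot> f = f"
    and Comp_assoc:
      "f \<in> hom C W X \<Longrightarrow> g \<in> hom C X Y \<Longrightarrow> h \<in> hom C Y Z \<Longrightarrow> (h \<cdot> g) \<cdot> f = h \<cdot> (g \<cdot> f)"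

definition isomorphism :: "('o, 'a, 'm) category_scheme \<Rightarrow> 'o \<Rightarrow> 'o \<Rightarrow> 'a \<Rightarrow> bool" where
  "isomorphism C X Y f \<longleftrightarrow> f \<in> hom C X Y \<and>
     (\<exists>g \<in> hom C Y X. g \<cdot>\<^bsub>C\<^esub> f = Id C X \<and> f \<cdot>\<^bsub>C\<^esub> g = Id C Y)"

definition prod_category ::
  "('o, 'a, 'm) category_scheme \<Rightarrow> ('p, 'b, 'n) category_scheme \<Rightarrow> ('o \<times> 'p, 'a \<times> 'b) category"
where
  "prod_category C D =
    \<lparr>Obj = Obj C \<times> Obj D, Arr = Arr C \<times> Arr D,
     Dom = map_prod (Dom C) (Dom D), Cod = map_prod (Cod C) (Cod D),
     Id = map_prod (Id C) (Id D),
     Comp = (\<lambda>(g, g') (f, f'). (g \<cdot>\<^bsub>C\<^esub> f, g' \<cdot>\<^bsub>D\<^esub> f'))\<rparr>"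

record ('o, 'a, 'p, 'b) cat_functor =
  fobj :: "'o \<Rightarrow> 'p"
  farr :: "'a \<Rightarrow> 'b"

locale cat_functor = C: category C + D: category D
  for C :: "('o, 'a, 'm) category_scheme" and D :: "('p, 'b, 'n) category_scheme" +
  fixes F :: "('o, 'a, 'p, 'b, 'k) cat_functor_scheme"
  assumes fobj_closed: "X \<in> Obj C \<Longrightarrow> fobj F X \<in> Obj D"
    and farr_in_hom: "f \<in> hom C X Y \<Longrightarrow> farr F f \<in> hom D (fobj F X) (fobj F Y)"
    and farr_Id: "X \<in> Obj C \<Longrightarrow> farr F (Id C X) = Id D (fobj F X)"
    and farr_Comp: "f \<in> hom C X Y \<Longrightarrow> g \<in> hom C Y Z \<Longrightarrow>
      farr F (g \<cdot>\<^bsub>C\<^esub> f) = farr F g \<cdot>\<^bsub>D\<^esub> farr F f"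

definition id_functor :: "('o, 'a, 'o, 'a) cat_functor" where
  "id_functor = \<lparr>fobj = (\<lambda>X. X), farr = (\<lambda>f. f)\<rparr>"

definition comp_functor ::
  "('p, 'b, 'q, 'c, 'l) cat_functor_scheme \<Rightarrow> ('o, 'a, 'p, 'b, 'k) cat_functor_scheme \<Rightarrow>
   ('o, 'a, 'q, 'c) cat_functor" where
  "comp_functor G F = \<lparr>fobj = fobj G \<circ> fobj F, farr = farr G \<circ> farr F\<rparr>"

definition prod_functor ::
  "('o, 'a, 'p, 'b, 'k) cat_functor_scheme \<Rightarrow> ('q, 'c, 'r, 'd, 'l) cat_functor_scheme \<Rightarrow>
   ('o \<times> 'q, 'a \<times> 'c, 'p \<times> 'r, 'b \<times> 'd) cat_functor" where
  "prod_functor F G =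
    \<lparr>fobj = map_prod (fobj F) (fobj G), farr = map_prod (farr F) (farr G)\<rparr>"

locale natural_isomorphism = F: cat_functor C D F + G: cat_functor C D G
  for C :: "('o, 'a, 'm) category_scheme" and D :: "('p, 'b, 'n) category_scheme"
    and F :: "('o, 'a, 'p, 'b, 'k) cat_functor_scheme"
    and G :: "('o, 'a, 'p, 'b, 'l) cat_functor_scheme" +
  fixes \<eta> :: "'o \<Rightarrow> 'b"
  assumes component_iso: "X \<in> Obj C \<Longrightarrow> isomorphism D (fobj F X) (fobj G X) (\<eta> X)"
    and naturality: "f \<in> hom C X Y \<Longrightarrow> farr G f \<cdot>\<^bsub>D\<^esub> \<eta> X = \<eta> Y \<cdot>\<^bsub>D\<^esub> farr F f"


section \<open>Semi-monoidal categories and LR units\<close>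

record ('o, 'a) semi_monoidal_category = "('o, 'a) category" +
  tensor :: "('o \<times> 'o, 'a \<times> 'a, 'o, 'a) cat_functor"

abbreviation tensor_obj ::
  "('o, 'a, 'm) semi_monoidal_category_scheme \<Rightarrow> 'o \<Rightarrow> 'o \<Rightarrow> 'o" (infixr "\<odot>\<index>" 75) where
  "tensor_obj C X Y \<equiv> fobj (tensor C) (X, Y)"

abbreviation tensor_arr ::
  "('o, 'a, 'm) semi_monoidal_category_scheme \<Rightarrow> 'a \<Rightarrow> 'a \<Rightarrow> 'a" (infixr "\<otimes>\<index>" 75) where
  "tensor_arr C f g \<equiv> farr (tensor C) (f, g)"

locale semi_monoidal_category =
  category C + tensor: cat_functor "prod_category C C" C "tensor C"
  for C :: "('o, 'a, 'm) semi_monoidal_category_scheme" (structure) +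
  assumes tensor_obj_assoc:
      "X \<in> Obj C \<Longrightarrow> Y \<in> Obj C \<Longrightarrow> Z \<in> Obj C \<Longrightarrow> (X \<odot> Y) \<odot> Z = X \<odot> (Y \<odot> Z)"
    and tensor_arr_assoc:
      "f \<in> Arr C \<Longrightarrow> g \<in> Arr C \<Longrightarrow> h \<in> Arr C \<Longrightarrow> (f \<otimes> g) \<otimes> h = f \<otimes> (g \<otimes> h)"

definition left_tensor_functor ::
  "('o, 'a, 'm) semi_monoidal_category_scheme \<Rightarrow> 'o \<Rightarrow> ('o, 'a, 'o, 'a) cat_functor" where
  "left_tensor_functor C X = \<lparr>fobj = (\<lambda>Y. X \<odot>\<^bsub>C\<^esub> Y), farr = (\<lambda>f. Id C X \<otimes>\<^bsub>C\<^esub> f)\<rparr>"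

definition right_tensor_functor ::
  "('o, 'a, 'm) semi_monoidal_category_scheme \<Rightarrow> 'o \<Rightarrow> ('o, 'a, 'o, 'a) cat_functor" where
  "right_tensor_functor C X = \<lparr>fobj = (\<lambda>Y. Y \<odot>\<^bsub>C\<^esub> X), farr = (\<lambda>f. f \<otimes>\<^bsub>C\<^esub> Id C X)\<rparr>"

locale LR_unit = semi_monoidal_category C
  for C :: "('o, 'a, 'm) semi_monoidal_category_scheme" (structure) +
  fixes I :: 'o and l :: "'o \<Rightarrow> 'a" and r :: "'o \<Rightarrow> 'a"
  assumes unit_in_Obj: "I \<in> Obj C"
    and left_natural_iso: "natural_isomorphism C C (left_tensor_functor C I) id_functor l"
    and right_natural_iso: "natural_isomorphism C C (right_tensor_functor C I) id_functor r"
    and left_eq_right: "l I = r I"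
    and left_tensor: "X \<in> Obj C \<Longrightarrow> Y \<in> Obj C \<Longrightarrow> l (X \<odot> Y) = l X \<otimes> Id C Y"
    and right_tensor: "X \<in> Obj C \<Longrightarrow> Y \<in> Obj C \<Longrightarrow> r (X \<odot> Y) = Id C X \<otimes> r Y"
    and middle: "X \<in> Obj C \<Longrightarrow> Y \<in> Obj C \<Longrightarrow> Id C X \<otimes> l Y = r X \<otimes> Id C Y"

record ('o, 'a) monoidal_category = "('o, 'a) semi_monoidal_category" +
  unit_obj :: 'o
  lunit :: "'o \<Rightarrow> 'a"
  runit :: "'o \<Rightarrow> 'a"

locale monoidal_category = LR_unit C "unit_obj C" "lunit C" "runit C"
  for C :: "('o, 'a, 'm) monoidal_category_scheme" (structure)


section \<open>Strong multiplicative functors\<close>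

record ('o, 'a, 'p, 'b) multiplicative_functor = "('o, 'a, 'p, 'b) cat_functor" +
  mult :: "'o \<times> 'o \<Rightarrow> 'b"

locale strong_multiplicative_functor =
  C: semi_monoidal_category C + D: semi_monoidal_category D + cat_functor C D F
  for C :: "('o, 'a, 'm) semi_monoidal_category_scheme"
    and D :: "('p, 'b, 'n) semi_monoidal_category_scheme"
    and F :: "('o, 'a, 'p, 'b, 'k) multiplicative_functor_scheme" +
  assumes mult_natural_iso:
      "natural_isomorphism (prod_category C C) D
         (comp_functor (tensor D) (prod_functor F F)) (comp_functor F (tensor C)) (mult F)"
    and mult_assoc: "X \<in> Obj C \<Longrightarrow> Y \<in> Obj C \<Longrightarrow> Z \<in> Obj C \<Longrightarrow>
      mult F (X \<odot>\<^bsub>C\<^esub> Y, Z) \<cdot>\<^bsub>D\<^esub> (mult F (X, Y) \<otimes>\<^bsub>D\<^esub> Id D (fobj F Z)) =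
      mult F (X, Y \<odot>\<^bsub>C\<^esub> Z) \<cdot>\<^bsub>D\<^esub> (Id D (fobj F X) \<otimes>\<^bsub>D\<^esub> mult F (Y, Z))"

definition left_unit_condition ::
  "('o, 'a, 'm) monoidal_category_scheme \<Rightarrow> ('p, 'b, 'n) monoidal_category_scheme \<Rightarrow>
   ('o, 'a, 'p, 'b, 'k) multiplicative_functor_scheme \<Rightarrow> 'b \<Rightarrow> 'o \<Rightarrow> bool" where
  "left_unit_condition C D F \<phi>\<^sub>0 X \<longleftrightarrow>
     lunit D (fobj F X) =
       farr F (lunit C X) \<cdot>\<^bsub>D\<^esub> mult F (unit_obj C, X) \<cdot>\<^bsub>D\<^esub> (\<phi>\<^sub>0 \<otimes>\<^bsub>D\<^esub> Id D (fobj F X))"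

definition right_unit_condition ::
  "('o, 'a, 'm) monoidal_category_scheme \<Rightarrow> ('p, 'b, 'n) monoidal_category_scheme \<Rightarrow>
   ('o, 'a, 'p, 'b, 'k) multiplicative_functor_scheme \<Rightarrow> 'b \<Rightarrow> 'o \<Rightarrow> bool" where
  "right_unit_condition C D F \<phi>\<^sub>0 X \<longleftrightarrow>
     runit D (fobj F X) =
       farr F (runit C X) \<cdot>\<^bsub>D\<^esub> mult F (X, unit_obj C) \<cdot>\<^bsub>D\<^esub> (Id D (fobj F X) \<otimes>\<^bsub>D\<^esub> \<phi>\<^sub>0)"

end

theory Submission
  imports Defs
begin

text \<open>
  Write \<open>K = F(I)\<close>, and let \<open>l\<^sub>X : J F(X) \<rightarrow> F(X)\<close> and \<open>r\<^sub>X : F(X) J \<rightarrow> F(X)\<close> be the right-hand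
  sides of \<open>(L\<^sub>X)\<close> and \<open>(R\<^sub>X)\<close>. The middle axiom of \<open>I\<close>, transported along \<open>F\<close> and \<open>\<phi>\<^sub>2\<close>, gives
  \<open>F(X) l\<^sub>Y = r\<^sub>X F(Y)\<close> for all \<open>X, Y\<close>, while the middle axiom of \<open>J\<close> gives
  \<open>F(X) \<lambda> = \<rho> F(Y)\<close>. So \<open>(R\<^sub>I)\<close> implies \<open>K l\<^sub>Y = K \<lambda>\<close> for all \<open>Y\<close>; since \<open>K \<cong> J\<close>, tensoring
  with \<open>K\<close> is faithful, and \<open>(L\<^sub>Y)\<close> follows. Symmetrically \<open>(L\<^sub>I)\<close> implies \<open>(R\<^sub>X)\<close> for all \<open>X\<close>.
\<close>

section \<open>Typing of arrows and cancellation of isomorphisms\<close>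

lemma isomorphism_in_hom: "isomorphism C X Y f \<Longrightarrow> f \<in> hom C X Y"
  by (simp add: isomorphism_def)

lemma hom_Arr: "f \<in> hom C X Y \<Longrightarrow> f \<in> Arr C"
  by (simp add: hom_def)

lemma hom_prod_category:
  "hom (prod_category C D) (X, X') (Y, Y') = hom C X Y \<times> hom D X' Y'"
  by (auto simp: hom_def prod_category_def)

context category
begin

lemma hom_Obj:
  assumes "f \<in> hom C X Y"
  shows "X \<in> Obj C" "Y \<in> Obj C"
  using assms Dom_closed Cod_closed by (auto simp: hom_def)

lemma isomorphism_cancel_right:
  assumes e: "isomorphism C X Y e" and f: "f \<in> hom C Y Z" and g: "g \<in> hom C Y Z"
    and eq: "f \<cdot> e = g \<cdot> e"
  shows "f = g"
proof -
  obtain d where d: "d \<in> hom C Y X" "e \<cdot> d = Id C Y" and e': "e \<in> hom C X Y"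
    using e by (auto simp: isomorphism_def)
  have "f = (f \<cdot> e) \<cdot> d"
    using Comp_assoc[OF d(1) e' f] Comp_Id[OF f] d(2) by simp
  also have "\<dots> = g"
    unfolding eq using Comp_assoc[OF d(1) e' g] Comp_Id[OF g] d(2) by simp
  finally show ?thesis .
qed

lemma isomorphism_cancel_left:
  assumes e: "isomorphism C Y Z e" and f: "f \<in> hom C X Y" and g: "g \<in> hom C X Y"
    and eq: "e \<cdot> f = e \<cdot> g"
  shows "f = g"
proof -
  obtain d where d: "d \<in> hom C Z Y" "d \<cdot> e = Id C Y" and e': "e \<in> hom C Y Z"
    using e by (auto simp: isomorphism_def)
  have "f = d \<cdot> (e \<cdot> f)"
    using Comp_assoc[OF f e' d(1)] Id_Comp[OF f] d(2) by simp
  also have "\<dots> = g"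
    unfolding eq using Comp_assoc[OF g e' d(1)] Id_Comp[OF g] d(2) by simp
  finally show ?thesis .
qed

end

section \<open>Calculus of the strict tensor product\<close>

context semi_monoidal_category
begin

lemma tensor_obj_closed: "X \<in> Obj C \<Longrightarrow> Y \<in> Obj C \<Longrightarrow> X \<odot> Y \<in> Obj C"
  using tensor.fobj_closed[of "(X, Y)"] by (simp add: prod_category_def)

lemma tensor_in_hom:
  "f \<in> hom C X Y \<Longrightarrow> g \<in> hom C X' Y' \<Longrightarrow> f \<otimes> g \<in> hom C (X \<odot> X') (Y \<odot> Y')"
  using tensor.farr_in_hom[of "(f, g)" "(X, X')" "(Y, Y')"] by (simp add: hom_prod_category)

lemma tensor_Id: "X \<in> Obj C \<Longrightarrow> Y \<in> Obj C \<Longrightarrow> Id C X \<otimes> Id C Y = Id C (X \<odot> Y)"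
  using tensor.farr_Id[of "(X, Y)"] by (simp add: prod_category_def)

lemma interchange:
  assumes "f \<in> hom C X Y" "g \<in> hom C Y Z" "f' \<in> hom C X' Y'" "g' \<in> hom C Y' Z'"
  shows "(g \<otimes> g') \<cdot> (f \<otimes> f') = (g \<cdot> f) \<otimes> (g' \<cdot> f')"
  using tensor.farr_Comp[of "(f, f')" "(X, X')" "(Y, Y')" "(g, g')" "(Z, Z')"] assms
  \<comment> \<open>Two passes, because \<open>hom_prod_category\<close> matches only while
    \<open>prod_category\<close> is still folded.\<close>
  by (simp add: hom_prod_category) (simp add: prod_category_def)

lemma interchange_Id_left:
  assumes "X \<in> Obj C" "f \<in> hom C U V" "g \<in> hom C V W"
  shows "(Id C X \<otimes> g) \<cdot> (Id C X \<otimes> f) = Id C X \<otimes> (g \<cdot> f)"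
  using interchange[OF Id_in_hom Id_in_hom assms(2,3)] assms(1) Comp_Id[OF Id_in_hom] by simp

lemma interchange_Id_right:
  assumes "X \<in> Obj C" "f \<in> hom C U V" "g \<in> hom C V W"
  shows "(g \<otimes> Id C X) \<cdot> (f \<otimes> Id C X) = (g \<cdot> f) \<otimes> Id C X"
  using interchange[OF assms(2,3) Id_in_hom Id_in_hom] assms(1) Comp_Id[OF Id_in_hom] by simp

text \<open>By interchange and the identity laws both composites equal
  \<open>f \<otimes> g\<close>.\<close>

lemma tensor_slide:
  assumes "f \<in> hom C X Y" "g \<in> hom C X' Y'"
  shows "(f \<otimes> Id C Y') \<cdot> (Id C X \<otimes> g) = (Id C Y \<otimes> g) \<cdot> (f \<otimes> Id C X')"
  using interchange[OF Id_in_hom assms(1) assms(2) Id_in_hom]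
    interchange[OF assms(1) Id_in_hom Id_in_hom assms(2)]
    hom_Obj[OF assms(1)] hom_Obj[OF assms(2)]
    Comp_Id[OF assms(1)] Comp_Id[OF assms(2)] Id_Comp[OF assms(1)] Id_Comp[OF assms(2)]
  by simp

lemma tensor_isomorphism:
  assumes "isomorphism C X Y f" "isomorphism C X' Y' f'"
  shows "isomorphism C (X \<odot> X') (Y \<odot> Y') (f \<otimes> f')"
proof -
  obtain g g' where
    g: "f \<in> hom C X Y" "g \<in> hom C Y X" "g \<cdot> f = Id C X" "f \<cdot> g = Id C Y" and
    g': "f' \<in> hom C X' Y'" "g' \<in> hom C Y' X'" "g' \<cdot> f' = Id C X'" "f' \<cdot> g' = Id C Y'"
    using assms by (auto simp: isomorphism_def)
  show ?thesis
    unfolding isomorphism_def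
  proof (intro conjI bexI)
    show "f \<otimes> f' \<in> hom C (X \<odot> X') (Y \<odot> Y')" "g \<otimes> g' \<in> hom C (Y \<odot> Y') (X \<odot> X')"
      by (intro tensor_in_hom g g')+
    show "(g \<otimes> g') \<cdot> (f \<otimes> f') = Id C (X \<odot> X')"
      using interchange[OF g(1,2) g'(1,2)] g(3) g'(3) tensor_Id hom_Obj[OF g(1)] hom_Obj[OF g'(1)]
      by simp
    show "(f \<otimes> f') \<cdot> (g \<otimes> g') = Id C (Y \<odot> Y')"
      using interchange[OF g(2,1) g'(2,1)] g(4) g'(4) tensor_Id hom_Obj[OF g(1)] hom_Obj[OF g'(1)]
      by simp
  qed
qed

lemma Id_isomorphism: "X \<in> Obj C \<Longrightarrow> isomorphism C X X (Id C X)"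
  unfolding isomorphism_def using Id_in_hom Comp_Id by blast

end

section \<open>Faithfulness of tensoring with an object isomorphic to the unit\<close>

context LR_unit
begin

lemma left_isomorphism: "X \<in> Obj C \<Longrightarrow> isomorphism C (I \<odot> X) X (l X)"
  using natural_isomorphism.component_iso[OF left_natural_iso]
  by (simp add: left_tensor_functor_def id_functor_def)

lemma right_isomorphism: "X \<in> Obj C \<Longrightarrow> isomorphism C (X \<odot> I) X (r X)"
  using natural_isomorphism.component_iso[OF right_natural_iso]
  by (simp add: right_tensor_functor_def id_functor_def)

lemma left_naturality: "f \<in> hom C X Y \<Longrightarrow> f \<cdot> l X = l Y \<cdot> (Id C I \<otimes> f)"
  using natural_isomorphism.naturality[OF left_natural_iso]
  by (simp add: left_tensor_functor_def id_functor_def)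

lemma right_naturality: "f \<in> hom C X Y \<Longrightarrow> f \<cdot> r X = r Y \<cdot> (f \<otimes> Id C I)"
  using natural_isomorphism.naturality[OF right_natural_iso]
  by (simp add: right_tensor_functor_def id_functor_def)

text \<open>The isomorphism \<open>e\<close> carries the equality from \<open>K\<close> to
  \<open>I\<close>; naturality of \<open>l\<close> then gives
  \<open>f \<cdot> l X = g \<cdot> l X\<close>, and \<open>l X\<close> is invertible.\<close>

lemma left_tensor_faithful:
  assumes e: "isomorphism C I K e" and f: "f \<in> hom C X Y" and g: "g \<in> hom C X Y"
    and eq: "Id C K \<otimes> f = Id C K \<otimes> g"
  shows "f = g"
proof -
  note XY = hom_Obj[OF f] and eh = isomorphism_in_hom[OF e]
  have "Id C I \<otimes> f = Id C I \<otimes> g"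
  proof (rule isomorphism_cancel_left)
    show "isomorphism C (I \<odot> Y) (K \<odot> Y) (e \<otimes> Id C Y)"
      by (rule tensor_isomorphism[OF e Id_isomorphism[OF XY(2)]])
    \<comment> \<open>Sliding turns the two sides into \<open>Id C K \<otimes> f\<close> and
      \<open>Id C K \<otimes> g\<close>, each after \<open>e \<otimes> Id C X\<close>.\<close>
    show "(e \<otimes> Id C Y) \<cdot> (Id C I \<otimes> f) = (e \<otimes> Id C Y) \<cdot> (Id C I \<otimes> g)"
      using tensor_slide[OF eh f] tensor_slide[OF eh g] eq by simp
  qed (use tensor_in_hom Id_in_hom unit_in_Obj f g in blast)+
  then have "f \<cdot> l X = g \<cdot> l X"
    using left_naturality f g by simp
  then show ?thesis
    by (rule isomorphism_cancel_right[OF left_isomorphism[OF XY(1)] f g])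
qed

text \<open>Mirror image of \<open>left_tensor_faithful\<close>, with \<open>r\<close> in place of
  \<open>l\<close>.\<close>

lemma right_tensor_faithful:
  assumes e: "isomorphism C I K e" and f: "f \<in> hom C X Y" and g: "g \<in> hom C X Y"
    and eq: "f \<otimes> Id C K = g \<otimes> Id C K"
  shows "f = g"
proof -
  note XY = hom_Obj[OF f] and eh = isomorphism_in_hom[OF e]
  have "f \<otimes> Id C I = g \<otimes> Id C I"
  proof (rule isomorphism_cancel_left)
    show "isomorphism C (Y \<odot> I) (Y \<odot> K) (Id C Y \<otimes> e)"
      by (rule tensor_isomorphism[OF Id_isomorphism[OF XY(2)] e])
    show "(Id C Y \<otimes> e) \<cdot> (f \<otimes> Id C I) = (Id C Y \<otimes> e) \<cdot> (g \<otimes> Id C I)"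
      using tensor_slide[OF f eh] tensor_slide[OF g eh] eq by simp
  qed (use tensor_in_hom Id_in_hom unit_in_Obj f g in blast)+
  then have "f \<cdot> r X = g \<cdot> r X"
    using right_naturality f g by simp
  then show ?thesis
    by (rule isomorphism_cancel_right[OF right_isomorphism[OF XY(1)] f g])
qed

end

section \<open>Componentwise form of the natural isomorphism \<open>mult F\<close>\<close>

context strong_multiplicative_functor
begin

lemma mult_isomorphism:
  "X \<in> Obj C \<Longrightarrow> Y \<in> Obj C \<Longrightarrow>
    isomorphism D (fobj F X \<odot>\<^bsub>D\<^esub> fobj F Y) (fobj F (X \<odot>\<^bsub>C\<^esub> Y)) (mult F (X, Y))"
  using natural_isomorphism.component_iso[OF mult_natural_iso, of "(X, Y)"]
  by (simp add: prod_category_def comp_functor_def prod_functor_def)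

lemma mult_naturality:
  "f \<in> hom C X Y \<Longrightarrow> g \<in> hom C X' Y' \<Longrightarrow>
    farr F (f \<otimes>\<^bsub>C\<^esub> g) \<cdot>\<^bsub>D\<^esub> mult F (X, X') = mult F (Y, Y') \<cdot>\<^bsub>D\<^esub> (farr F f \<otimes>\<^bsub>D\<^esub> farr F g)"
  using natural_isomorphism.naturality[OF mult_natural_iso, of "(f, g)" "(X, X')" "(Y, Y')"]
  by (simp add: hom_prod_category comp_functor_def prod_functor_def)

end

section \<open>Comparison of the units along \<open>F\<close>\<close>

locale unital_comparison =
  strong_multiplicative_functor C D F + I: LR_unit C I l r + J: LR_unit D J l' r'
  for C :: "('o, 'a, 'm) semi_monoidal_category_scheme"
    and D :: "('p, 'b, 'n) semi_monoidal_category_scheme"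
    and F :: "('o, 'a, 'p, 'b, 'k) multiplicative_functor_scheme"
    and I l r J l' r' +
  fixes e :: 'b
  assumes e_iso: "isomorphism D J (fobj F I) e"
begin

text \<open>What remains of the right-hand side of (L_X) once \<phi>_0 is dropped. Here
  \<open>l\<close> and \<open>r\<close> are the unit constraints of \<open>C\<close>; the composites
  l_X and r_X of the idea are \<open>left_candidate\<close> and
  \<open>right_candidate\<close>.\<close>

abbreviation left_action :: "'o \<Rightarrow> 'b" where
  "left_action X \<equiv> farr F (l X) \<cdot>\<^bsub>D\<^esub> mult F (I, X)"

abbreviation right_action :: "'o \<Rightarrow> 'b" where
  "right_action X \<equiv> farr F (r X) \<cdot>\<^bsub>D\<^esub> mult F (X, I)"

lemma left_action_in_hom:
  "X \<in> Obj C \<Longrightarrow> left_action X \<in> hom D (fobj F I \<odot>\<^bsub>D\<^esub> fobj F X) (fobj F X)"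
  by (meson D.Comp_in_hom I.left_isomorphism I.unit_in_Obj farr_in_hom isomorphism_in_hom
      mult_isomorphism)

lemma right_action_in_hom:
  "X \<in> Obj C \<Longrightarrow> right_action X \<in> hom D (fobj F X \<odot>\<^bsub>D\<^esub> fobj F I) (fobj F X)"
  by (meson D.Comp_in_hom I.right_isomorphism I.unit_in_Obj farr_in_hom isomorphism_in_hom
      mult_isomorphism)

text \<open>After composing with the invertible \<phi>_{X,Y}, naturality of \<open>mult F\<close>
  moves the tensor with an identity inside \<open>F\<close>, where the middle axiom of
  \<open>I\<close> can be applied.\<close>

lemma actions_middle:
  assumes X: "X \<in> Obj C" and Y: "Y \<in> Obj C"
  shows "Id D (fobj F X) \<otimes>\<^bsub>D\<^esub> left_action Y = right_action X \<otimes>\<^bsub>D\<^esub> Id D (fobj F Y)"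
proof (rule D.isomorphism_cancel_left[OF mult_isomorphism[OF X Y]])
  note FX = fobj_closed[OF X] and FY = fobj_closed[OF Y]
  note FI = fobj_closed[OF I.unit_in_Obj]
  note XI = C.tensor_obj_closed[OF X I.unit_in_Obj]
  note IY = C.tensor_obj_closed[OF I.unit_in_Obj Y]
  note lY = isomorphism_in_hom[OF I.left_isomorphism[OF Y]]
  note rX = isomorphism_in_hom[OF I.right_isomorphism[OF X]]
  note mult_hom = isomorphism_in_hom[OF mult_isomorphism]
  let ?A = "fobj F X \<odot>\<^bsub>D\<^esub> fobj F I \<odot>\<^bsub>D\<^esub> fobj F Y"
  \<comment> \<open>The two sides have sources bracketed differently; strict associativity on
    objects makes them parallel, as cancellation requires.\<close>
  have assoc: "(fobj F X \<odot>\<^bsub>D\<^esub> fobj F I) \<odot>\<^bsub>D\<^esub> fobj F Y = ?A"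
    by (rule D.tensor_obj_assoc[OF FX FI FY])
  show "Id D (fobj F X) \<otimes>\<^bsub>D\<^esub> left_action Y \<in> hom D ?A (fobj F X \<odot>\<^bsub>D\<^esub> fobj F Y)"
    by (intro D.tensor_in_hom D.Id_in_hom FX left_action_in_hom Y)
  show "right_action X \<otimes>\<^bsub>D\<^esub> Id D (fobj F Y) \<in> hom D ?A (fobj F X \<odot>\<^bsub>D\<^esub> fobj F Y)"
    unfolding assoc[symmetric]
    by (intro D.tensor_in_hom D.Id_in_hom FY right_action_in_hom X)
  \<comment> \<open>Interchange splits off F(\<lambda>_Y), and naturality of \<open>mult F\<close>
    at \<open>Id C X\<close>, \<open>l Y\<close> moves \<phi> past it.\<close>
  have left: "mult F (X, Y) \<cdot>\<^bsub>D\<^esub> (Id D (fobj F X) \<otimes>\<^bsub>D\<^esub> left_action Y) =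
      farr F (Id C X \<otimes>\<^bsub>C\<^esub> l Y) \<cdot>\<^bsub>D\<^esub> mult F (X, I \<odot>\<^bsub>C\<^esub> Y)
        \<cdot>\<^bsub>D\<^esub> (Id D (fobj F X) \<otimes>\<^bsub>D\<^esub> mult F (I, Y))"
  proof -
    have a: "Id D (fobj F X) \<otimes>\<^bsub>D\<^esub> mult F (I, Y) \<in> hom D ?A (fobj F X \<odot>\<^bsub>D\<^esub> fobj F (I \<odot>\<^bsub>C\<^esub> Y))"
      by (intro D.tensor_in_hom D.Id_in_hom FX mult_hom I.unit_in_Obj Y)
    have b: "Id D (fobj F X) \<otimes>\<^bsub>D\<^esub> farr F (l Y)
        \<in> hom D (fobj F X \<odot>\<^bsub>D\<^esub> fobj F (I \<odot>\<^bsub>C\<^esub> Y)) (fobj F X \<odot>\<^bsub>D\<^esub> fobj F Y)"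
      by (intro D.tensor_in_hom D.Id_in_hom FX farr_in_hom lY)
    have c: "farr F (Id C X \<otimes>\<^bsub>C\<^esub> l Y)
        \<in> hom D (fobj F (X \<odot>\<^bsub>C\<^esub> I \<odot>\<^bsub>C\<^esub> Y)) (fobj F (X \<odot>\<^bsub>C\<^esub> Y))"
      by (intro C.tensor_in_hom C.Id_in_hom X farr_in_hom lY)
    show ?thesis
      using D.interchange_Id_left[OF FX mult_hom[OF I.unit_in_Obj Y] farr_in_hom[OF lY]]
        D.Comp_assoc[OF a b mult_hom[OF X Y]] D.Comp_assoc[OF a mult_hom[OF X IY] c]
        mult_naturality[OF C.Id_in_hom[OF X] lY] farr_Id[OF X]
      by simp
  qed
  \<comment> \<open>The mirrored computation, with naturality at \<open>r X\<close>,
    \<open>Id C Y\<close>.\<close>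
  have right: "mult F (X, Y) \<cdot>\<^bsub>D\<^esub> (right_action X \<otimes>\<^bsub>D\<^esub> Id D (fobj F Y)) =
      farr F (r X \<otimes>\<^bsub>C\<^esub> Id C Y) \<cdot>\<^bsub>D\<^esub> mult F (X \<odot>\<^bsub>C\<^esub> I, Y)
        \<cdot>\<^bsub>D\<^esub> (mult F (X, I) \<otimes>\<^bsub>D\<^esub> Id D (fobj F Y))"
  proof -
    have a: "mult F (X, I) \<otimes>\<^bsub>D\<^esub> Id D (fobj F Y)
        \<in> hom D ((fobj F X \<odot>\<^bsub>D\<^esub> fobj F I) \<odot>\<^bsub>D\<^esub> fobj F Y) (fobj F (X \<odot>\<^bsub>C\<^esub> I) \<odot>\<^bsub>D\<^esub> fobj F Y)"
      by (intro D.tensor_in_hom D.Id_in_hom FY mult_hom I.unit_in_Obj X)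
    have b: "farr F (r X) \<otimes>\<^bsub>D\<^esub> Id D (fobj F Y)
        \<in> hom D (fobj F (X \<odot>\<^bsub>C\<^esub> I) \<odot>\<^bsub>D\<^esub> fobj F Y) (fobj F X \<odot>\<^bsub>D\<^esub> fobj F Y)"
      by (intro D.tensor_in_hom D.Id_in_hom FY farr_in_hom rX)
    have c: "farr F (r X \<otimes>\<^bsub>C\<^esub> Id C Y)
        \<in> hom D (fobj F ((X \<odot>\<^bsub>C\<^esub> I) \<odot>\<^bsub>C\<^esub> Y)) (fobj F (X \<odot>\<^bsub>C\<^esub> Y))"
      by (intro C.tensor_in_hom C.Id_in_hom Y farr_in_hom rX)
    show ?thesis
      using D.interchange_Id_right[OF FY mult_hom[OF X I.unit_in_Obj] farr_in_hom[OF rX]]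
        D.Comp_assoc[OF a b mult_hom[OF X Y]] D.Comp_assoc[OF a mult_hom[OF XI Y] c]
        mult_naturality[OF rX C.Id_in_hom[OF Y]] farr_Id[OF Y]
      by simp
  qed
  \<comment> \<open>The middle axiom identifies the arrows under \<open>F\<close>, and
    \<open>mult_assoc\<close> at \<open>X\<close>, \<open>I\<close>, \<open>Y\<close> identifies the
    remaining composites.\<close>
  show "mult F (X, Y) \<cdot>\<^bsub>D\<^esub> (Id D (fobj F X) \<otimes>\<^bsub>D\<^esub> left_action Y) =
      mult F (X, Y) \<cdot>\<^bsub>D\<^esub> (right_action X \<otimes>\<^bsub>D\<^esub> Id D (fobj F Y))"
    unfolding left right I.middle[OF X Y] mult_assoc[OF X I.unit_in_Obj Y] ..
qed

text \<open>Bracketed so that the action stays a single factor, to which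
  \<open>actions_middle\<close> applies.\<close>

abbreviation left_candidate :: "'o \<Rightarrow> 'b" where
  "left_candidate X \<equiv> left_action X \<cdot>\<^bsub>D\<^esub> (e \<otimes>\<^bsub>D\<^esub> Id D (fobj F X))"

abbreviation right_candidate :: "'o \<Rightarrow> 'b" where
  "right_candidate X \<equiv> right_action X \<cdot>\<^bsub>D\<^esub> (Id D (fobj F X) \<otimes>\<^bsub>D\<^esub> e)"

lemma left_candidate_in_hom:
  "X \<in> Obj C \<Longrightarrow> left_candidate X \<in> hom D (J \<odot>\<^bsub>D\<^esub> fobj F X) (fobj F X)"
  by (meson D.Comp_in_hom D.Id_in_hom D.tensor_in_hom e_iso fobj_closed isomorphism_in_hom
      left_action_in_hom)

lemma right_candidate_in_hom:
  "X \<in> Obj C \<Longrightarrow> right_candidate X \<in> hom D (fobj F X \<odot>\<^bsub>D\<^esub> J) (fobj F X)"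
  by (meson D.Comp_in_hom D.Id_in_hom D.tensor_in_hom e_iso fobj_closed isomorphism_in_hom
      right_action_in_hom)

text \<open>By strict associativity on arrows, \<open>e\<close> enters both sides as the same arrow
  F(X) e F(Y); what is composed after it agrees by \<open>actions_middle\<close>.\<close>

lemma candidates_middle:
  assumes X: "X \<in> Obj C" and Y: "Y \<in> Obj C"
  shows "Id D (fobj F X) \<otimes>\<^bsub>D\<^esub> left_candidate Y = right_candidate X \<otimes>\<^bsub>D\<^esub> Id D (fobj F Y)"
proof -
  note FX = fobj_closed[OF X] and FY = fobj_closed[OF Y]
  note e = isomorphism_in_hom[OF e_iso]
  note eY = D.tensor_in_hom[OF e D.Id_in_hom[OF FY]]
  note Xe = D.tensor_in_hom[OF D.Id_in_hom[OF FX] e]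
  show ?thesis
    using D.interchange_Id_left[OF FX eY left_action_in_hom[OF Y]]
      D.interchange_Id_right[OF FY Xe right_action_in_hom[OF X]]
      D.tensor_arr_assoc[OF hom_Arr[OF D.Id_in_hom[OF FX]] hom_Arr[OF e]
        hom_Arr[OF D.Id_in_hom[OF FY]]] actions_middle[OF X Y]
    by simp
qed

text \<open>The middle axiom of \<open>J\<close> turns F(I) \<lambda>_{F(X)} into \<rho>_{F(I)}
  F(X), where the hypothesis applies; \<open>candidates_middle\<close> leads back to F(I) tensored
  with the left candidate, and F(I) is cancelled by faithfulness.\<close>

lemma right_at_unit_imp_left:
  assumes "r' (fobj F I) = right_candidate I" and X: "X \<in> Obj C"
  shows "l' (fobj F X) = left_candidate X"
proof (rule J.left_tensor_faithful[OF e_iso])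
  note FX = fobj_closed[OF X] and FI = fobj_closed[OF I.unit_in_Obj]
  show "l' (fobj F X) \<in> hom D (J \<odot>\<^bsub>D\<^esub> fobj F X) (fobj F X)"
    by (rule isomorphism_in_hom[OF J.left_isomorphism[OF FX]])
  show "Id D (fobj F I) \<otimes>\<^bsub>D\<^esub> l' (fobj F X) = Id D (fobj F I) \<otimes>\<^bsub>D\<^esub> left_candidate X"
    using J.middle[OF FI FX] candidates_middle[OF I.unit_in_Obj X] assms(1) by simp
qed (rule left_candidate_in_hom[OF X])

text \<open>The mirrored argument: F(I) now stands on the right, so both middle identities are used
  with F(I) as second factor.\<close>

lemma left_at_unit_imp_right:
  assumes "l' (fobj F I) = left_candidate I" and X: "X \<in> Obj C"
  shows "r' (fobj F X) = right_candidate X"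
proof (rule J.right_tensor_faithful[OF e_iso])
  note FX = fobj_closed[OF X] and FI = fobj_closed[OF I.unit_in_Obj]
  show "r' (fobj F X) \<in> hom D (fobj F X \<odot>\<^bsub>D\<^esub> J) (fobj F X)"
    by (rule isomorphism_in_hom[OF J.right_isomorphism[OF FX]])
  show "r' (fobj F X) \<otimes>\<^bsub>D\<^esub> Id D (fobj F I) = right_candidate X \<otimes>\<^bsub>D\<^esub> Id D (fobj F I)"
    using J.middle[OF FX FI] candidates_middle[OF X I.unit_in_Obj] assms(1) by simp
qed (rule right_candidate_in_hom[OF X])

text \<open>Passes to the bracketing used in (L_X); \<open>X\<close> must be an object, since
  associativity holds only for composable arrows.\<close>

lemma left_candidate_alt:
  assumes X: "X \<in> Obj C"
  shows "left_candidate X = farr F (l X) \<cdot>\<^bsub>D\<^esub> mult F (I, X) \<cdot>\<^bsub>D\<^esub> (e \<otimes>\<^bsub>D\<^esub> Id D (fobj F X))"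
  using D.Comp_assoc[OF D.tensor_in_hom[OF isomorphism_in_hom[OF e_iso]
        D.Id_in_hom[OF fobj_closed[OF X]]]
      isomorphism_in_hom[OF mult_isomorphism[OF I.unit_in_Obj X]]
      farr_in_hom[OF isomorphism_in_hom[OF I.left_isomorphism[OF X]]]] .

lemma right_candidate_alt:
  assumes X: "X \<in> Obj C"
  shows "right_candidate X = farr F (r X) \<cdot>\<^bsub>D\<^esub> mult F (X, I) \<cdot>\<^bsub>D\<^esub> (Id D (fobj F X) \<otimes>\<^bsub>D\<^esub> e)"
  using D.Comp_assoc[OF D.tensor_in_hom[OF D.Id_in_hom[OF fobj_closed[OF X]]
        isomorphism_in_hom[OF e_iso]]
      isomorphism_in_hom[OF mult_isomorphism[OF X I.unit_in_Obj]]
      farr_in_hom[OF isomorphism_in_hom[OF I.right_isomorphism[OF X]]]] .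

end

section \<open>Equivalence of the unit conditions\<close>

theorem corollary3p12:
  fixes C :: "('o, 'a) monoidal_category"
    and D :: "('p, 'b) monoidal_category"
    and F :: "('o, 'a, 'p, 'b) multiplicative_functor"
    and \<phi>\<^sub>0 :: 'b
  assumes "monoidal_category C"
    and "monoidal_category D"
    and "strong_multiplicative_functor C D F"
    and "isomorphism D (unit_obj D) (fobj F (unit_obj C)) \<phi>\<^sub>0"
  shows
    "((\<forall>X \<in> Obj C. left_unit_condition C D F \<phi>\<^sub>0 X) \<longleftrightarrow>
        (\<forall>X \<in> Obj C. right_unit_condition C D F \<phi>\<^sub>0 X)) \<and>
     ((\<forall>X \<in> Obj C. left_unit_condition C D F \<phi>\<^sub>0 X) \<longleftrightarrow>
        left_unit_condition C D F \<phi>\<^sub>0 (unit_obj C)) \<and>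
     ((\<forall>X \<in> Obj C. left_unit_condition C D F \<phi>\<^sub>0 X) \<longleftrightarrow>
        right_unit_condition C D F \<phi>\<^sub>0 (unit_obj C)) \<and>
     ((\<forall>X \<in> Obj C. right_unit_condition C D F \<phi>\<^sub>0 X) \<longleftrightarrow>
        left_unit_condition C D F \<phi>\<^sub>0 (unit_obj C)) \<and>
     ((\<forall>X \<in> Obj C. right_unit_condition C D F \<phi>\<^sub>0 X) \<longleftrightarrow>
        right_unit_condition C D F \<phi>\<^sub>0 (unit_obj C))"
proof -
  interpret C: monoidal_category C by (rule assms(1))
  interpret D: monoidal_category D by (rule assms(2))
  interpret strong_multiplicative_functor C D F by (rule assms(3))
  interpret unital_comparison C D F "unit_obj C" "lunit C" "runit C"
    "unit_obj D" "lunit D" "runit D" \<phi>\<^sub>0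
    by unfold_locales (rule assms(4))
  have left: "left_unit_condition C D F \<phi>\<^sub>0 X \<longleftrightarrow> lunit D (fobj F X) = left_candidate X"
    and right: "right_unit_condition C D F \<phi>\<^sub>0 X \<longleftrightarrow> runit D (fobj F X) = right_candidate X"
    if "X \<in> Obj C" for X
    using left_candidate_alt[OF that] right_candidate_alt[OF that]
    by (simp_all only: left_unit_condition_def right_unit_condition_def)
  have "right_unit_condition C D F \<phi>\<^sub>0 (unit_obj C) \<Longrightarrow> \<forall>X \<in> Obj C. left_unit_condition C D F \<phi>\<^sub>0 X"
    using right_at_unit_imp_left left right C.unit_in_Obj by blast
  moreover
  have "left_unit_condition C D F \<phi>\<^sub>0 (unit_obj C) \<Longrightarrow> \<forall>X \<in> Obj C. right_unit_condition C D F \<phi>\<^sub>0 X"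
    using left_at_unit_imp_right left right C.unit_in_Obj by blast
  \<comment> \<open>Since the unit is itself an object, the two implications close the cycle (R_I),
    all (L_X), (L_I), all (R_X), (R_I), which contains every claimed equivalence.\<close>
  ultimately show ?thesis
    using C.unit_in_Obj by blast
qed

end
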